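(* Let $m,n\ge 1$ be integers, and let $b(m,n)$ denote the number of orbits of the action of $D_m\times D_n$ on the set $X_{m,n}$ of $m\times n$ binary arrays by rotations and reflections of the rows and of the columns. Then $$b(m,n)=b_1(m,n)+b_2(m,n)+b_3(m,n)+b_4(m,n),$$ where $$b_1(m,n)=\frac{1}{4mn}\sum_{c\,|\,m}\;\sum_{d\,|\,n}\varphi(c)\varphi(d)\,2^{mn/\mathrm{lcm}(c,d)};$$ where, if $m$ is odd, $$b_2(m,n)=\frac{1}{4n}2^{(m+1)n/2}+\frac{1}{4n}\sum_{d\ge2,\;d\,|\,n}\varphi(d)\,2^{mn/d}+\frac{1}{4n}\sum_{\substack{1\le j\le n-1\\ n/\gcd(j,n)\text{ is odd}}}\left[2^{(m+1)\gcd(j,n)/2}-2^{m\gcd(j,n)}\right],$$ and, if $m$ is even, $$b_2(m,n)=\frac{1}{8n}\left[2^{mn/2}+2^{(m+2)n/2}\right]+\frac{1}{4n}\sum_{d\ge2,\;d\,|\,n}\varphi(d)\,2^{mn/d}+\frac{1}{8n}\sum_{\substack{1\le j\le n-1\\ n/\gcd(j,n)\text{ is odd}}}\left[2^{m\gcd(j,n)/2}+2^{(m+2)\gcd(j,n)/2}-2^{m\gcd(j,n)+1}\right];$$ where $$b_3(m,n)=b_2(n,m)$$ (that is, if $n$ is odd, $$b_3(m,n)=\frac{1}{4m}2^{(n+1)m/2}+\frac{1}{4m}\sum_{d\ge2,\;d\,|\,m}\varphi(d)\,2^{mn/d}+\frac{1}{4m}\sum_{\substack{1\le j\le m-1\\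 m/\gcd(j,m)\text{ is odd}}}\left[2^{(n+1)\gcd(j,m)/2}-2^{n\gcd(j,m)}\right],$$ and, if $n$ is even, $$b_3(m,n)=\frac{1}{8m}\left[2^{mn/2}+2^{(n+2)m/2}\right]+\frac{1}{4m}\sum_{d\ge2,\;d\,|\,m}\varphi(d)\,2^{mn/d}+\frac{1}{8m}\sum_{\substack{1\le j\le m-1\\ m/\gcd(j,m)\text{ is odd}}}\left[2^{n\gcd(j,m)/2}+2^{(n+2)\gcd(j,m)/2}-2^{n\gcd(j,m)+1}\right]);$$ and where $$b_4(m,n)=\begin{cases}2^{(mn-3)/2}&\text{if $m$ and $n$ are odd},\\ 3\cdot2^{mn/2-3}&\text{if $m$ and $n$ have opposite parity},\\ 7\cdot2^{mn/2-4}&\text{if $m$ and $n$ are even}.\end{cases}$$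
   Context: $X_{m,n}:=\{0,1\}^{\{0,1,\ldots,m-1\}\times\{0,1,\ldots,n-1\}}$ is the set of $m\times n$ arrays of 0s and 1s; it has $2^{mn}$ elements. $D_m$ denotes the dihedral group of order $2m$ (for every $m\ge1$). The group $D_m\times D_n$ acts on $X_{m,n}$ as follows: $D_m$ acts by permuting the rows, generated by the rotation $\sigma$ of the rows (row $0$ becomes row $1$, row $1$ becomes row $2$, ..., row $m-1$ becomes row $0$) and the reflection $\rho$ of the rows (row $i$ and row $m-1-i$ are interchanged for each $i$); $D_n$ acts by permuting the columns in the same way, generated by the analogous rotation $\tau$ and reflection $\theta$ of the columns. (For $m\le 2$ or $n\le 2$ this action need not be faithful.) Thus $b(m,n)$ is the number of distinct toroidal $m\times n$ binary arrays, allowing rotation and/or reflection of the rows and/or the columns. $\varphi$ is Euler's phi function, $\mathrm{lcm}$ is the least common multiple, and $\gcd$ is the greatest common divisor. Sums over $c\,|\,m$ and $d\,|\,n$ run over positive divisors, and empty sums are $0$. *)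

theory Defs
  imports Complex_Main "HOL-Algebra.Group_Action" "HOL-Number_Theory.Totient"
begin

(* The pair (a, s) stands for r^a * f^s, where r is the rotation of order m and f is a reflection,
   so that f * r * f = inverse r.  For m = 1 and m = 2 this still has 2 * m elements. *)
definition dihedral :: "nat \<Rightarrow> (int \<times> bool) monoid" where
  "dihedral m =
     \<lparr>carrier = {0..<int m} \<times> UNIV,
      monoid.mult = (\<lambda>(a, s) (b, t). ((a + (if s then - b else b)) mod int m, s \<noteq> t)),
      monoid.one = (0, False)\<rparr>"

(* The permutation of the indices 0, ..., m-1 given by r^a * f^s, where
   r sends i to i + 1 modulo m and f sends i to m - 1 - i. *)
definition dihedral_perm :: "nat \<Rightarrow> int \<times> bool \<Rightarrow> int \<Rightarrow> int" where
  "dihedral_perm m = (\<lambda>(a, s) i. (a + (if s then int m - 1 - i else i)) mod int m)"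

definition cells :: "nat \<Rightarrow> nat \<Rightarrow> (int \<times> int) set" where
  "cells m n = {0..<int m} \<times> {0..<int n}"

definition arrays :: "nat \<Rightarrow> nat \<Rightarrow> (int \<times> int \<Rightarrow> nat) set" where
  "arrays m n = cells m n \<rightarrow>\<^sub>E {0, 1}"

(* The entry of the new array at cell p is the entry of the old array at the preimage of p,
   i.e. g moves row i to row dihedral_perm m g i and h moves columns likewise. *)
definition array_action ::
    "nat \<Rightarrow> nat \<Rightarrow> (int \<times> bool) \<times> (int \<times> bool) \<Rightarrow> (int \<times> int \<Rightarrow> nat) \<Rightarrow> (int \<times> int \<Rightarrow> nat)" where
  "array_action m n = (\<lambda>(g, h). \<lambda>x\<in>arrays m n. \<lambda>(i, j)\<in>cells m n.
     x (dihedral_perm m (inv\<^bsub>dihedral m\<^esub> g) i, dihedral_perm n (inv\<^bsub>dihedral n\<^esub> h) j))"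

definition toroidal_count :: "nat \<Rightarrow> nat \<Rightarrow> nat" where
  "toroidal_count m n = card (orbits (dihedral m \<times>\<times> dihedral n) (arrays m n) (array_action m n))"

definition b1 :: "nat \<Rightarrow> nat \<Rightarrow> real" where
  "b1 m n = 1 / (4 * real m * real n) *
     (\<Sum>c | c dvd m. \<Sum>d | d dvd n.
        real (totient c) * real (totient d) * 2 powr (real m * real n / real (lcm c d)))"

definition b2 :: "nat \<Rightarrow> nat \<Rightarrow> real" where
  "b2 m n =
    (if odd m then
       1 / (4 * real n) * 2 powr ((real m + 1) * real n / 2)
       + 1 / (4 * real n) * (\<Sum>d | 2 \<le> d \<and> d dvd n. real (totient d) * 2 powr (real m * real n / real d))
       + 1 / (4 * real n) * (\<Sum>j | 1 \<le> j \<and> j \<le> n - 1 \<and> odd (n div gcd j n).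
           2 powr ((real m + 1) * real (gcd j n) / 2) - 2 powr (real m * real (gcd j n)))
     else
       1 / (8 * real n) * (2 powr (real m * real n / 2) + 2 powr ((real m + 2) * real n / 2))
       + 1 / (4 * real n) * (\<Sum>d | 2 \<le> d \<and> d dvd n. real (totient d) * 2 powr (real m * real n / real d))
       + 1 / (8 * real n) * (\<Sum>j | 1 \<le> j \<and> j \<le> n - 1 \<and> odd (n div gcd j n).
           2 powr (real m * real (gcd j n) / 2) + 2 powr ((real m + 2) * real (gcd j n) / 2)
           - 2 powr (real m * real (gcd j n) + 1)))"

definition b3 :: "nat \<Rightarrow> nat \<Rightarrow> real" where
  "b3 m n = b2 n m"

definition b4 :: "nat \<Rightarrow> nat \<Rightarrow> real" where
  "b4 m n =
    (if odd m \<and> odd n then 2 powr ((real m * real n - 3) / 2)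
     else if odd m \<noteq> odd n then 3 * 2 powr (real m * real n / 2 - 3)
     else 7 * 2 powr (real m * real n / 2 - 4))"


lemma group_dihedral:
  assumes "m \<ge> 1"
  shows "group (dihedral m)"
proof (rule groupI)
  fix x assume x: "x \<in> carrier (dihedral m)"
  show "\<one>\<^bsub>dihedral m\<^esub> \<otimes>\<^bsub>dihedral m\<^esub> x = x"
    using x by (auto simp: dihedral_def)
  show "\<exists>y\<in>carrier (dihedral m). y \<otimes>\<^bsub>dihedral m\<^esub> x = \<one>\<^bsub>dihedral m\<^esub>"
  proof (cases "snd x")
    case True
    then show ?thesis using x by (intro bexI[of _ x]) (auto simp: dihedral_def)
  next
    case False
    then show ?thesis using x assms
      by (intro bexI[of _ "((- fst x) mod int m, False)"]) (auto simp: dihedral_def mod_simps)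
  qed
  fix y assume y: "y \<in> carrier (dihedral m)"
  show "x \<otimes>\<^bsub>dihedral m\<^esub> y \<in> carrier (dihedral m)"
    using assms by (auto simp: dihedral_def split: prod.splits)
  fix z assume z: "z \<in> carrier (dihedral m)"
  show "x \<otimes>\<^bsub>dihedral m\<^esub> y \<otimes>\<^bsub>dihedral m\<^esub> z = x \<otimes>\<^bsub>dihedral m\<^esub> (y \<otimes>\<^bsub>dihedral m\<^esub> z)"
    by (cases x; cases y; cases z) (auto simp: dihedral_def mod_simps algebra_simps)
next
  show "\<one>\<^bsub>dihedral m\<^esub> \<in> carrier (dihedral m)"
    using assms by (auto simp: dihedral_def)
qed

lemma order_dihedral: "order (dihedral m) = 2 * m"
  by (simp add: order_def dihedral_def card_cartesian_product)

lemma dihedral_perm_one: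
  "i \<in> {0..<int m} \<Longrightarrow> dihedral_perm m \<one>\<^bsub>dihedral m\<^esub> i = i"
  by (simp add: dihedral_perm_def dihedral_def)

lemma dihedral_perm_mult:
  "dihedral_perm m (g \<otimes>\<^bsub>dihedral m\<^esub> h) i = dihedral_perm m g (dihedral_perm m h i)"
proof -
  have flip: "(a + (int m - 1 - x mod int m)) mod int m = (a + (int m - 1 - x)) mod int m" for a x
    using mod_diff_right_eq[of "a + int m - 1" x "int m"] by (simp add: algebra_simps)
  have wrap: "(x + int m) mod int m = x mod int m" for x
    by simp
  obtain a s b t where [simp]: "g = (a, s)" "h = (b, t)" by (cases g; cases h)
  show ?thesis
    using wrap[of "a - b + i"]
    by (cases s; cases t) (simp_all add: dihedral_perm_def dihedral_def flip mod_simps, simp_all add: algebra_simps)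
qed

lemma dihedral_perm_in: "m \<ge> 1 \<Longrightarrow> dihedral_perm m g i \<in> {0..<int m}"
  by (cases g) (auto simp: dihedral_perm_def)

lemma dihedral_perm_rotation: "dihedral_perm m (1 mod int m, False) i = (i + 1) mod int m"
  by (simp add: dihedral_perm_def mod_simps add.commute)

lemma dihedral_perm_reflection:
  "i \<in> {0..<int m} \<Longrightarrow> dihedral_perm m (0, True) i = int m - 1 - i"
  by (simp add: dihedral_perm_def)

lemma array_action_moves:
  assumes "m \<ge> 1" "n \<ge> 1" "g \<in> carrier (dihedral m)" "h \<in> carrier (dihedral n)"
    and "x \<in> arrays m n" "i \<in> {0..<int m}" "j \<in> {0..<int n}"
  shows "array_action m n (g, h) x (dihedral_perm m g i, dihedral_perm n h j) = x (i, j)"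
proof -
  have "dihedral_perm k (inv\<^bsub>dihedral k\<^esub> f) (dihedral_perm k f l) = l"
    if "k \<ge> 1" "f \<in> carrier (dihedral k)" "l \<in> {0..<int k}" for k f l
    using that group.l_inv[OF group_dihedral, of k f] dihedral_perm_one[of l k]
    by (simp flip: dihedral_perm_mult)
  then show ?thesis
    using assms dihedral_perm_in[of m g i] dihedral_perm_in[of n h j]
    by (auto simp: array_action_def cells_def)
qed

lemma array_action_in:
  assumes "m \<ge> 1" "n \<ge> 1" "x \<in> arrays m n"
  shows "array_action m n gh x \<in> arrays m n"
proof -
  obtain g h where [simp]: "gh = (g, h)" by (cases gh)
  have "(dihedral_perm m g' i, dihedral_perm n h' j) \<in> cells m n" for g' h' i j
    using dihedral_perm_in assms(1,2) unfolding cells_def by blast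
  then have "x (dihedral_perm m g' i, dihedral_perm n h' j) \<in> {0, 1}" for g' h' i j
    using assms(3) unfolding arrays_def by (rule PiE_mem[rotated])
  then show ?thesis
    using assms(3) unfolding array_action_def by (simp add: arrays_def PiE_iff case_prod_unfold)
qed

lemma array_action_mult:
  assumes mn: "m \<ge> 1" "n \<ge> 1"
    and g: "g \<in> carrier (dihedral m \<times>\<times> dihedral n)" and h: "h \<in> carrier (dihedral m \<times>\<times> dihedral n)"
    and x: "x \<in> arrays m n"
  shows "array_action m n (g \<otimes>\<^bsub>dihedral m \<times>\<times> dihedral n\<^esub> h) x
           = array_action m n g (array_action m n h x)"
proof -
  obtain g1 g2 h1 h2 where [simp]: "g = (g1, g2)" "h = (h1, h2)" by (cases g; cases h)
  interpret G: group "dihedral m" using mn by (intro group_dihedral)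
  interpret H: group "dihedral n" using mn by (intro group_dihedral)
  have gh: "g1 \<in> carrier (dihedral m)" "h1 \<in> carrier (dihedral m)"
    "g2 \<in> carrier (dihedral n)" "h2 \<in> carrier (dihedral n)" using g h by auto
  have y: "array_action m n (h1, h2) x \<in> arrays m n" using array_action_in mn x .
  show ?thesis
  proof
    fix p :: "int \<times> int"
    obtain i j where [simp]: "p = (i, j)" by (cases p)
    have "(dihedral_perm m g1' i, dihedral_perm n g2' j) \<in> cells m n" for g1' g2'
      using dihedral_perm_in mn unfolding cells_def by blast
    then show "array_action m n (g \<otimes>\<^bsub>dihedral m \<times>\<times> dihedral n\<^esub> h) x p
        = array_action m n g (array_action m n h x) p"
      using x y gh
      by (simp add: array_action_def G.inv_mult_group H.inv_mult_group dihedral_perm_mult)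
  qed
qed

lemma array_action_one:
  assumes mn: "m \<ge> 1" "n \<ge> 1" and x: "x \<in> arrays m n"
  shows "array_action m n \<one>\<^bsub>dihedral m \<times>\<times> dihedral n\<^esub> x = x"
proof
  interpret G: group "dihedral m" using mn by (intro group_dihedral)
  interpret H: group "dihedral n" using mn by (intro group_dihedral)
  fix p :: "int \<times> int"
  show "array_action m n \<one>\<^bsub>dihedral m \<times>\<times> dihedral n\<^esub> x p = x p"
  proof (cases "p \<in> cells m n")
    case True
    then show ?thesis
      using x by (simp add: array_action_def cells_def mem_Times_iff case_prod_unfold dihedral_perm_one)
  next
    case False
    moreover have "x p = undefined"
      using x False unfolding arrays_def by (rule PiE_arb)
    ultimately show ?thesis
      using x by (simp add: array_action_def)
  qed
qed

lemma group_action_array_action: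
  assumes mn: "m \<ge> 1" "n \<ge> 1"
  shows "group_action (dihedral m \<times>\<times> dihedral n) (arrays m n) (array_action m n)"
proof -
  let ?G = "dihedral m \<times>\<times> dihedral n"
  interpret G: group ?G using mn by (intro DirProd_group group_dihedral)
  have bij: "array_action m n g \<in> carrier (BijGroup (arrays m n))" if g: "g \<in> carrier ?G" for g
  proof -
    have "bij_betw (array_action m n g) (arrays m n) (arrays m n)"
    proof (rule bij_betwI[of _ _ _ "array_action m n (inv\<^bsub>?G\<^esub> g)"])
      show "array_action m n g \<in> arrays m n \<rightarrow> arrays m n"
        "array_action m n (inv\<^bsub>?G\<^esub> g) \<in> arrays m n \<rightarrow> arrays m n"
        using array_action_in[OF mn] by auto
      fix x assume x: "x \<in> arrays m n"
      show "array_action m n (inv\<^bsub>?G\<^esub> g) (array_action m n g x) = x"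
        using array_action_mult[OF mn G.inv_closed[OF g] g x] array_action_one[OF mn x]
          G.l_inv[OF g] by metis
      show "array_action m n g (array_action m n (inv\<^bsub>?G\<^esub> g) x) = x"
        using array_action_mult[OF mn g G.inv_closed[OF g] x] array_action_one[OF mn x]
          G.r_inv[OF g] by metis
    qed
    then show ?thesis
      by (cases g) (auto simp: BijGroup_def Bij_def array_action_def)
  qed
  have "array_action m n \<in> hom ?G (BijGroup (arrays m n))"
  proof (rule homI)
    fix g h assume gh: "g \<in> carrier ?G" "h \<in> carrier ?G"
    have "array_action m n (g \<otimes>\<^bsub>?G\<^esub> h)
        = compose (arrays m n) (array_action m n g) (array_action m n h)"
    proof
      fix x
      show "array_action m n (g \<otimes>\<^bsub>?G\<^esub> h) x
          = compose (arrays m n) (array_action m n g) (array_action m n h) x"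
      proof (cases "x \<in> arrays m n")
        case True
        then show ?thesis using array_action_mult[OF mn gh] by (simp add: compose_def)
      next
        case False
        then show ?thesis
          by (auto simp: compose_def array_action_def split: prod.splits)
      qed
    qed
    then show "array_action m n (g \<otimes>\<^bsub>?G\<^esub> h)
        = array_action m n g \<otimes>\<^bsub>BijGroup (arrays m n)\<^esub> array_action m n h"
      using bij[OF gh(1)] bij[OF gh(2)] by (simp add: BijGroup_def)
  qed (rule bij)
  then show ?thesis
    by (simp add: group_action_def group_hom_def group_hom_axioms_def group_BijGroup G.group_axioms)
qed

end

theory Submission
  imports Defs "HOL-Algebra.Elementary_Groups"
begin

text \<open>
  By Burnside's lemma, \<open>4 m n b(m, n)\<close> is the sum over all \<open>(g, h)\<close> of the number of arrays fixed by
  \<open>(g, h)\<close>, which is 2 to the number of cycles of \<open>(g, h)\<close> on the cells. These cycles are counted by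
  Burnside's lemma again, now for the cyclic group of order \<open>N = 2 m n\<close> acting through the powers
  of \<open>(g, h)\<close>: the number of cycles times \<open>N\<close> is the sum over \<open>k < N\<close> of
  \<open>fix(g\<^sup>k) fix(h\<^sup>k)\<close>, because a power fixes a cell iff it fixes both its row and its column.
  For a rotation of order \<open>d\<close>, \<open>fix(g\<^sup>k)\<close> is \<open>m\<close> if \<open>d\<close> divides \<open>k\<close> and 0 otherwise; for a
  reflection it alternates between \<open>m\<close> and the number of fixed points of the reflection, which is 1
  for odd \<open>m\<close> and equally often 0 and 2 for even \<open>m\<close>. The four combinations of rotations and
  reflections give \<open>b\<^sub>1, \<dots>, b\<^sub>4\<close>.
\<close>

section \<open>Iterates of a permutation as a cyclic group action\<close>

lemma funpow_mod_period:
  fixes p :: "'a \<Rightarrow> 'a"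
  assumes "p \<in> S \<rightarrow> S" and period: "\<And>x. x \<in> S \<Longrightarrow> (p ^^ N) x = x" and x: "x \<in> S"
  shows "(p ^^ (k mod N)) x = (p ^^ k) x"
proof -
  have "(p ^^ (N * q)) x = x" for q
    by (induction q) (simp_all add: funpow_add period x)
  then have "(p ^^ (k mod N + N * (k div N))) x = (p ^^ (k mod N)) x"
    unfolding funpow_add by simp
  then show ?thesis
    by simp
qed

lemma funpow_in_funcset: "p \<in> S \<rightarrow> S \<Longrightarrow> x \<in> S \<Longrightarrow> (p ^^ k) x \<in> S"
  by (induction k) auto

text \<open>Makes Burnside's lemma available for the powers of a single map. \<open>N\<close> may be
  any common period, so the action of the cyclic group need not be faithful.\<close>

lemma group_action_funpow:
  fixes p :: "'a \<Rightarrow> 'a"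
  assumes p: "p \<in> S \<rightarrow> S" and N: "N > 0" and period: "\<And>x. x \<in> S \<Longrightarrow> (p ^^ N) x = x"
  shows "group_action (integer_mod_group N) S (\<lambda>k. \<lambda>x\<in>S. (p ^^ nat k) x)"
    (is "group_action ?Z S ?act")
proof -
  have red: "(p ^^ (k mod N)) x = (p ^^ k) x" if "x \<in> S" for x k
    using funpow_mod_period[OF p period that] .
  have bij: "?act k \<in> carrier (BijGroup S)" if k: "k \<in> carrier ?Z" for k
  proof -
    \<comment> \<open>This bound keeps \<open>N - nat k\<close> from being truncated, so that the
      corresponding power of \<open>p\<close> inverts the power \<open>nat k\<close>.\<close>
    have "nat k < N"
      using k N by (auto simp: carrier_integer_mod_group split: if_splits)
    then have inverse: "(p ^^ (N - nat k)) ((p ^^ nat k) x) = x" "(p ^^ nat k) ((p ^^ (N - nat k)) x) = x"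
      if "x \<in> S" for x
      using period[OF that] funpow_add[of "N - nat k" "nat k" p] funpow_add[of "nat k" "N - nat k" p]
      by (simp_all add: o_def fun_eq_iff)
    have "bij_betw (?act k) S S"
      by (rule bij_betwI[of _ _ _ "p ^^ (N - nat k)"]) (simp_all add: inverse funpow_in_funcset[OF p])
    then show ?thesis
      by (auto simp: BijGroup_def Bij_def)
  qed
  have "?act \<in> hom ?Z (BijGroup S)"
  proof (rule homI)
    fix k l assume kl: "k \<in> carrier ?Z" "l \<in> carrier ?Z"
    have nn: "k \<ge> 0" "l \<ge> 0"
      using kl N by (auto simp: carrier_integer_mod_group split: if_splits)
    have "nat ((k + l) mod int N) = (nat k + nat l) mod N"
      using nn by (simp add: nat_mod_distrib nat_add_distrib)
    then have "?act (k \<otimes>\<^bsub>?Z\<^esub> l) = compose S (?act k) (?act l)"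
      using N by (auto simp: mult_integer_mod_group compose_def red funpow_add funpow_in_funcset[OF p])
    then show "?act (k \<otimes>\<^bsub>?Z\<^esub> l) = ?act k \<otimes>\<^bsub>BijGroup S\<^esub> ?act l"
      using bij[OF kl(1)] bij[OF kl(2)] by (simp add: BijGroup_def)
  qed (rule bij)
  then show ?thesis
    by (simp add: group_action_def group_hom_def group_hom_axioms_def group_BijGroup)
qed

text \<open>An invariant function is constant on the orbits of the powers of \<open>p\<close>, so it
  amounts to a free choice of a value in \<open>T\<close> for each orbit. The witness
  \<open>c\<close> is the number of orbits, and Burnside's lemma supplies the formula for
  it.\<close>

lemma card_invariant_functions:
  fixes p :: "'a \<Rightarrow> 'a"
  assumes S: "finite S" and p: "p \<in> S \<rightarrow> S" and N: "N > 0"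
    and period: "\<And>x. x \<in> S \<Longrightarrow> (p ^^ N) x = x" and T: "finite T"
  obtains c where "c * N = (\<Sum>k<N. card {x \<in> S. (p ^^ k) x = x})"
    and "card {f \<in> S \<rightarrow>\<^sub>E T. \<forall>x\<in>S. f (p x) = f x} = card T ^ c"
proof -
  let ?Z = "integer_mod_group N" and ?act = "\<lambda>k. \<lambda>x\<in>S. (p ^^ nat k) x"
  interpret group_action ?Z S ?act
    using group_action_funpow[OF p N period] .
  define Orb where "Orb = orbits ?Z S ?act"
  have carrier: "carrier ?Z = int ` {..<N}"
    using N by (simp add: carrier_integer_mod_group image_int_atLeastLessThan lessThan_atLeast0)
  have "card Orb * N = (\<Sum>k\<in>int ` {..<N}. card (invariants S ?act k))"
    using burnside[OF _ S] unfolding Orb_def order_def carrier by (simp add: card_image)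
  also have "\<dots> = (\<Sum>k<N. card {x \<in> S. (p ^^ k) x = x})"
    by (subst sum.reindex) (auto simp: invariants_def intro!: sum.cong arg_cong[of _ _ card])
  finally have count: "card Orb * N = \<dots>" .
  have orbit_eq: "orbit ?Z ?act x = {(p ^^ k) x | k. k < N}" if "x \<in> S" for x
    using that by (force simp: orbit_def carrier)
  have orbitI: "x \<in> S \<Longrightarrow> (p ^^ k) x \<in> orbit ?Z ?act x" for x k
    using N funpow_mod_period[OF p period] by (auto simp: orbit_eq intro!: exI[of _ "k mod N"])
  have orbit_p: "orbit ?Z ?act (p x) = orbit ?Z ?act x" if x: "x \<in> S" for x
  proof -
    have px: "p x \<in> S" using p x by auto
    have "p x \<in> orbit ?Z ?act x" using orbitI[OF x, of 1] by simp
    \<comment> \<open>Distinct orbits are disjoint, and \<open>p x\<close> lies in both of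
      these.\<close>
    then have "orbit ?Z ?act x \<inter> orbit ?Z ?act (p x) \<noteq> {}"
      using orbit_refl[OF px] by blast
    then show ?thesis
      using disjoint_union[of "orbit ?Z ?act x" "orbit ?Z ?act (p x)"] x px
      unfolding orbits_def by blast
  qed
  let ?I = "{f \<in> S \<rightarrow>\<^sub>E T. \<forall>x\<in>S. f (p x) = f x}"
  let ?lift = "\<lambda>F. \<lambda>x\<in>S. F (orbit ?Z ?act x)"
  have in_Orb: "x \<in> S \<Longrightarrow> orbit ?Z ?act x \<in> Orb" for x
    unfolding Orb_def orbits_def by blast
  have "bij_betw ?lift (Orb \<rightarrow>\<^sub>E T) ?I"
    unfolding bij_betw_def
  proof
    show "inj_on ?lift (Orb \<rightarrow>\<^sub>E T)"
    proof (rule inj_onI)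
      fix F G assume FG: "F \<in> Orb \<rightarrow>\<^sub>E T" "G \<in> Orb \<rightarrow>\<^sub>E T" and eq: "?lift F = ?lift G"
      show "F = G"
      proof (rule PiE_ext[OF FG])
        fix o' assume "o' \<in> Orb"
        then obtain x where "x \<in> S" "o' = orbit ?Z ?act x"
          unfolding Orb_def orbits_def by blast
        then show "F o' = G o'"
          using fun_cong[OF eq, of x] by simp
      qed
    qed
    show "?lift ` (Orb \<rightarrow>\<^sub>E T) = ?I"
    proof
      show "?lift ` (Orb \<rightarrow>\<^sub>E T) \<subseteq> ?I"
        using p by (auto simp: in_Orb orbit_p Pi_iff PiE_iff)
      show "?I \<subseteq> ?lift ` (Orb \<rightarrow>\<^sub>E T)"
      proof
        fix f assume f: "f \<in> ?I"
        have inv: "f ((p ^^ k) x) = f x" if "x \<in> S" for x k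
          using f funpow_in_funcset[OF p that] by (induction k) auto
        \<comment> \<open>By \<open>inv\<close>, \<open>f\<close> takes one value on each orbit, so
          the chosen representative does not matter.\<close>
        define F where "F = (\<lambda>o'\<in>Orb. f (SOME x. x \<in> o'))"
        have F: "F (orbit ?Z ?act x) = f x" if x: "x \<in> S" for x
        proof -
          have "(SOME y. y \<in> orbit ?Z ?act x) \<in> orbit ?Z ?act x"
            using orbit_refl[OF x] by (rule someI)
          then show ?thesis
            using in_Orb[OF x] x inv by (auto simp: F_def orbit_eq)
        qed
        have "F \<in> Orb \<rightarrow>\<^sub>E T"
        proof
          fix o' assume "o' \<in> Orb"
          then obtain x where "x \<in> S" "o' = orbit ?Z ?act x"
            unfolding Orb_def orbits_def by blast
          then show "F o' \<in> T" using F f by auto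
        qed (simp add: F_def)
        moreover have "f = ?lift F"
          using f F by (auto simp: fun_eq_iff PiE_iff extensional_def)
        ultimately show "f \<in> ?lift ` (Orb \<rightarrow>\<^sub>E T)" by blast
      qed
    qed
  qed
  then have "card ?I = card (Orb \<rightarrow>\<^sub>E T)"
    by (simp add: bij_betw_same_card)
  also have "\<dots> = card T ^ card Orb"
  proof -
    have "Orb = (\<lambda>x. orbit ?Z ?act x) ` S" unfolding Orb_def orbits_def by blast
    then show ?thesis using S by (simp add: card_funcsetE)
  qed
  finally show thesis using that count by blast
qed

section \<open>Fixed points of powers of rotations and reflections\<close>

definition fixed_count :: "nat \<Rightarrow> int \<times> bool \<Rightarrow> nat \<Rightarrow> nat" where
  "fixed_count m g k = card {i \<in> {0..<int m}. (dihedral_perm m g ^^ k) i = i}"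

text \<open>Burnside's formula for the number of cycles of \<open>(g, h)\<close> on the cells, with
  the common period \<open>2*m*n\<close>. For \<open>m\<close> and \<open>n\<close> positive and
  \<open>g\<close>, \<open>h\<close> in the dihedral groups the division is exact, by
  \<open>cycle_count_mult\<close>.\<close>

definition cycle_count :: "nat \<Rightarrow> nat \<Rightarrow> int \<times> bool \<Rightarrow> int \<times> bool \<Rightarrow> nat" where
  "cycle_count m n g h = (\<Sum>k<2*m*n. fixed_count m g k * fixed_count n h k) div (2*m*n)"

lemma cycle_count_swap: "cycle_count m n g h = cycle_count n m h g"
  by (simp add: cycle_count_def mult.commute mult.left_commute)

lemma funpow_rotation:
  assumes "i \<in> {0..<int m}"
  shows "(dihedral_perm m (a, False) ^^ k) i = (i + int k * a) mod int m"
  using assms by (induction k) (auto simp: dihedral_perm_def mod_simps algebra_simps)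

lemma funpow_involution: "p (p x) = x \<Longrightarrow> (p ^^ k) x = (if even k then x else p x)"
  by (induction k) auto

lemma funpow_reflection:
  assumes "i \<in> {0..<int m}"
  shows "(dihedral_perm m (a, True) ^^ k) i = (if even k then i else dihedral_perm m (a, True) i)"
proof (rule funpow_involution)
  have "(a, True) \<otimes>\<^bsub>dihedral m\<^esub> (a, True) = \<one>\<^bsub>dihedral m\<^esub>"
    by (simp add: dihedral_def)
  then show "dihedral_perm m (a, True) (dihedral_perm m (a, True) i) = i"
    using dihedral_perm_one[OF assms] by (metis dihedral_perm_mult)
qed

text \<open>Rotations return after any multiple of \<open>m\<close> steps and reflections after any
  even number of steps; a multiple of \<open>2 * m\<close> serves both.\<close>

lemma funpow_dihedral_perm_period:
  assumes "i \<in> {0..<int m}" "2 * m dvd N"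
  shows "(dihedral_perm m g ^^ N) i = i"
proof -
  obtain a s where g: "g = (a, s)" by (cases g)
  have "even N" "int m dvd int N"
    using assms(2) by (auto dest: dvd_mult_left dvd_mult_right)
  then show ?thesis
    using assms(1) by (cases s) (auto simp: g funpow_rotation funpow_reflection mod_add_right_eq[symmetric])
qed

text \<open>All or nothing: whether a shift by \<open>k * a\<close> fixes an index does not depend
  on the index.\<close>

lemma fixed_count_rotation:
  assumes "m \<ge> 1"
  shows "fixed_count m (int a, False) k = (if m div gcd a m dvd k then m else 0)"
proof -
  have "(i + int k * int a) mod int m = i \<longleftrightarrow> m dvd k * a" if i: "i \<in> {0..<int m}" for i
  proof -
    have "(i + int k * int a) mod int m = i \<longleftrightarrow> (i + int k * int a) mod int m = i mod int m"
      using i by simp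
    also have "\<dots> \<longleftrightarrow> int m dvd int (k * a)"
      by (simp add: mod_eq_dvd_iff)
    finally show ?thesis by (simp only: int_dvd_int_iff)
  qed
  \<comment> \<open>Since \<open>m\<close> divides \<open>k * m\<close>, it divides
    \<open>k * a\<close> iff it divides \<open>gcd (k * a) (k * m) = k * gcd a m\<close>.\<close>
  moreover have "m dvd k * a \<longleftrightarrow> m div gcd a m dvd k"
    using assms div_dvd_iff_mult[of "gcd a m" m k] gcd_mult_distrib_nat[of k a m]
    by (simp add: mult.commute)
  ultimately have "{i \<in> {0..<int m}. (dihedral_perm m (int a, False) ^^ k) i = i}
      = (if m div gcd a m dvd k then {0..<int m} else {})"
    by (auto simp: funpow_rotation)
  then show ?thesis by (simp add: fixed_count_def)
qed

definition reflection_fixed :: "nat \<Rightarrow> nat \<Rightarrow> nat" where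
  "reflection_fixed m a = (if odd m then 1 else if even a then 0 else 2)"

text \<open>A fixed index solves \<open>2 * i = a - 1\<close> modulo \<open>m\<close>, which leaves
  only the values \<open>a - 1\<close> and \<open>a + m - 1\<close> for \<open>2 * i\<close>. For
  odd \<open>m\<close> exactly one of them is even; for even \<open>m\<close> both are even or both
  are odd, according to the parity of \<open>a\<close>.\<close>

lemma card_fixed_reflection:
  assumes a: "a < m"
  shows "card {i \<in> {0..<int m}. dihedral_perm m (int a, True) i = i} = reflection_fixed m a"
proof -
  have eq: "dihedral_perm m (int a, True) i = i \<longleftrightarrow> 2 * i = int a - 1 \<or> 2 * i = int a + int m - 1"
    if i: "i \<in> {0..<int m}" for i
  \<comment> \<open>The sum under \<open>mod\<close> wraps around once exactly when
    \<open>i < a\<close>; this separates the two equations.\<close>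
  proof (cases "i < int a")
    case True
    have "(int a + (int m - 1 - i)) mod int m = (int a - 1 - i + int m) mod int m"
      by (simp add: algebra_simps)
    also have "\<dots> = int a - 1 - i"
      using True i a by simp
    finally show ?thesis using True a by (auto simp: dihedral_perm_def)
  next
    case False
    then have "(int a + (int m - 1 - i)) mod int m = int a + (int m - 1 - i)"
      using i by simp
    then show ?thesis using False i by (auto simp: dihedral_perm_def)
  qed
  define F where "F = {i \<in> {0..<int m}. dihedral_perm m (int a, True) i = i}"
  \<comment> \<open>The bound \<open>i < m\<close> is implied, because \<open>2 * i\<close> is at
    most \<open>a + m - 1 < 2 * m\<close>.\<close>
  have F: "i \<in> F \<longleftrightarrow> i \<ge> 0 \<and> (2 * i = int a - 1 \<or> 2 * i = int a + int m - 1)" for i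
    unfolding F_def using eq[of i] a by auto
  consider (oo) b l where "m = 2 * l + 1" "a = 2 * b + 1" | (oe) b l where "m = 2 * l + 1" "a = 2 * b"
    | (ee) b l where "m = 2 * l" "a = 2 * b" | (eo) b l where "m = 2 * l" "a = 2 * b + 1"
    by (metis oddE evenE)
  then have "card F = reflection_fixed m a"
  proof cases
    case oo
    then have "F = {int b}" by (auto simp: F) presburger+
    then show ?thesis using oo by (simp add: reflection_fixed_def)
  next
    case oe
    then have "F = {int b + int l}" by (auto simp: F) presburger+
    then show ?thesis using oe by (simp add: reflection_fixed_def)
  next
    case ee
    then have "F = {}" by (auto simp: F) presburger+
    then show ?thesis using ee by (simp add: reflection_fixed_def)
  next
    case eo
    then have "F = {int b, int b + int l}" "l > 0" using a by (auto simp: F) 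
    then show ?thesis using eo by (simp add: reflection_fixed_def)
  qed
  then show ?thesis by (simp add: F_def)
qed

lemma fixed_count_reflection:
  assumes "a < m"
  shows "fixed_count m (int a, True) k = (if even k then m else reflection_fixed m a)"
proof -
  have "{i \<in> {0..<int m}. (dihedral_perm m (int a, True) ^^ k) i = i}
     = (if even k then {0..<int m} else {i \<in> {0..<int m}. dihedral_perm m (int a, True) i = i})"
    by (auto simp: funpow_reflection)
  then show ?thesis
    using card_fixed_reflection[OF assms] by (simp add: fixed_count_def)
qed

section \<open>Arrays fixed by a pair of dihedral elements\<close>

lemma invariants_array_action:
  assumes mn: "m \<ge> 1" "n \<ge> 1" and gh: "g \<in> carrier (dihedral m)" "h \<in> carrier (dihedral n)"
  shows "invariants (arrays m n) (array_action m n) (g, h)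
    = {x \<in> arrays m n. \<forall>q\<in>cells m n. x (map_prod (dihedral_perm m g) (dihedral_perm n h) q) = x q}"
proof -
  have "array_action m n (g, h) x = x \<longleftrightarrow>
      (\<forall>i\<in>{0..<int m}. \<forall>j\<in>{0..<int n}. x (dihedral_perm m g i, dihedral_perm n h j) = x (i, j))"
    (is "?L \<longleftrightarrow> ?R") if x: "x \<in> arrays m n" for x
  proof
    assume ?L
    then show ?R using array_action_moves[OF mn gh x] by simp
  next
    assume R: ?R
    interpret G: group "dihedral m" using mn by (intro group_dihedral)
    interpret H: group "dihedral n" using mn by (intro group_dihedral)
    have "array_action m n (g, h) x (i, j) = x (i, j)" if ij: "i \<in> {0..<int m}" "j \<in> {0..<int n}" for i j
    proof -
      \<comment> \<open>The action reads the old array at the preimage \<open>(i', j')\<close> of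
        \<open>(i, j)\<close>, so \<open>R\<close> is applied there.\<close>
      define i' j' where "i' = dihedral_perm m (inv\<^bsub>dihedral m\<^esub> g) i"
        and "j' = dihedral_perm n (inv\<^bsub>dihedral n\<^esub> h) j"
      have "i' \<in> {0..<int m}" "j' \<in> {0..<int n}"
        using dihedral_perm_in mn unfolding i'_def j'_def by blast+
      moreover have "dihedral_perm m g i' = i" "dihedral_perm n h j' = j"
        using gh dihedral_perm_one ij unfolding i'_def j'_def by (simp_all flip: dihedral_perm_mult)
      ultimately show ?thesis
        using array_action_moves[OF mn gh x, of i' j'] R by auto
    qed
    moreover have "array_action m n (g, h) x q = x q" if "q \<notin> cells m n" for q
      using that x PiE_arb[of x "cells m n"] by (simp add: array_action_def arrays_def)
    ultimately have "array_action m n (g, h) x q = x q" for q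
      by (cases "q \<in> cells m n") (auto simp: cells_def)
    then show ?L by (rule ext)
  qed
  then show ?thesis
    by (auto simp: invariants_def cells_def)
qed

lemma funpow_map_prod:
  fixes f :: "'a \<Rightarrow> 'a" and g :: "'b \<Rightarrow> 'b"
  shows "map_prod f g ^^ k = map_prod (f ^^ k) (g ^^ k)"
  by (induction k) (auto simp: fun_eq_iff)

text \<open>Fixed arrays are the functions invariant under the product permutation of the cells, so
  \<open>card_invariant_functions\<close> yields both claims at once, with the period
  \<open>2*m*n\<close> being a multiple of both \<open>2*m\<close> and \<open>2*n\<close>.\<close>

lemma
  assumes mn: "m \<ge> 1" "n \<ge> 1" and gh: "g \<in> carrier (dihedral m)" "h \<in> carrier (dihedral n)"
  shows card_invariants_array_action:
      "card (invariants (arrays m n) (array_action m n) (g, h)) = 2 ^ cycle_count m n g h" (is ?A)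
    and cycle_count_mult:
      "cycle_count m n g h * (2 * m * n) = (\<Sum>k<2*m*n. fixed_count m g k * fixed_count n h k)" (is ?B)
proof -
  let ?p = "map_prod (dihedral_perm m g) (dihedral_perm n h)"
  have p: "?p \<in> cells m n \<rightarrow> cells m n"
    unfolding cells_def by (rule funcsetI) (use dihedral_perm_in mn in \<open>simp add: mem_Times_iff\<close>)
  have period: "(?p ^^ (2 * m * n)) q = q" if "q \<in> cells m n" for q
    using that by (cases q) (simp add: cells_def funpow_map_prod funpow_dihedral_perm_period)
  have fixed: "card {q \<in> cells m n. (?p ^^ k) q = q} = fixed_count m g k * fixed_count n h k" for k
  proof -
    have "{q \<in> cells m n. (?p ^^ k) q = q} = {i \<in> {0..<int m}. (dihedral_perm m g ^^ k) i = i}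
        \<times> {j \<in> {0..<int n}. (dihedral_perm n h ^^ k) j = j}"
      by (auto simp: cells_def funpow_map_prod)
    then show ?thesis by (simp add: fixed_count_def card_cartesian_product)
  qed
  obtain c where c: "c * (2 * m * n) = (\<Sum>k<2*m*n. fixed_count m g k * fixed_count n h k)"
    and card: "card {x \<in> arrays m n. \<forall>q\<in>cells m n. x (?p q) = x q} = 2 ^ c"
    using card_invariant_functions[OF _ p _ period, of "{0, 1 :: nat}"] mn unfolding fixed
    by (auto simp: cells_def arrays_def numeral_2_eq_2)
  have "cycle_count m n g h = c"
    using mn unfolding cycle_count_def by (simp flip: c)
  then show ?A ?B
    using c card invariants_array_action[OF mn gh] by simp_all
qed

section \<open>Cycle counts for the four combinations of rotations and reflections\<close>

lemma sum_if_dvd: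
  fixes x :: nat
  assumes "L dvd N" "N > 0"
  shows "(\<Sum>k<N. if L dvd k then x else 0) = x * (N div L)"
proof -
  have L: "L > 0" using assms by (auto intro: Nat.gr0I)
  have "{k \<in> {..<N}. L dvd k} = (\<lambda>q. L * q) ` {..<N div L}"
  proof (rule Set.set_eqI)
    fix k
    have "k < N \<longleftrightarrow> q < N div L" if "k = L * q" for q
      using assms L that by (metis dvd_mult_div_cancel nat_mult_less_cancel1)
    then show "k \<in> {k \<in> {..<N}. L dvd k} \<longleftrightarrow> k \<in> (\<lambda>q. L * q) ` {..<N div L}"
      unfolding dvd_def by auto
  qed
  then have "card {k \<in> {..<N}. L dvd k} = N div L"
    using L by (simp add: card_image inj_on_def)
  then show ?thesis
    by (simp add: sum.If_cases Int_def mult.commute)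
qed

lemma div_gcd_dvd: "n div gcd b n dvd (n :: nat)"
  by (metis dvdI dvd_div_mult_self gcd_dvd2)

text \<open>The product of the fixed counts is \<open>m * n\<close> at the multiples of the lcm of
  the two orders and 0 elsewhere, so every cycle has that lcm as its length.\<close>

lemma cycle_count_rotations:
  assumes "a < m" "b < n"
  shows "cycle_count m n (int a, False) (int b, False) * lcm (m div gcd a m) (n div gcd b n) = m * n"
proof -
  let ?L = "lcm (m div gcd a m) (n div gcd b n)"
  have mn: "m \<ge> 1" "n \<ge> 1" using assms by auto
  have L: "?L dvd m * n"
    by (intro lcm_least dvd_mult dvd_mult2 div_gcd_dvd)
  have "cycle_count m n (int a, False) (int b, False) * (2 * m * n)
      = (\<Sum>k<2*m*n. if ?L dvd k then m * n else 0)"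
    using assms by (subst cycle_count_mult[OF mn])
      (auto simp: fixed_count_rotation[OF mn(1)] fixed_count_rotation[OF mn(2)] dihedral_def intro!: sum.cong)
  also have "\<dots> = m * n * (2 * m * n div ?L)"
    using mn L by (intro sum_if_dvd) (auto intro: dvd_mult simp: mult.assoc)
  finally have eq: "cycle_count m n (int a, False) (int b, False) * (2 * m * n)
      = m * n * (2 * m * n div ?L)" .
  have "2 * m * n div ?L * ?L = 2 * m * n"
    using dvd_mult[OF L, of 2] by (simp add: mult.assoc dvd_div_mult_self del: lcm_least_iff)
  moreover have "cycle_count m n (int a, False) (int b, False) * ?L * (2 * m * n)
      = cycle_count m n (int a, False) (int b, False) * (2 * m * n) * ?L"
    by (simp only: mult_ac)
  ultimately have "cycle_count m n (int a, False) (int b, False) * ?L * (2 * m * n) = m * n * (2 * m * n)"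
    unfolding eq by (simp only: mult.assoc)
  then show ?thesis using mn by simp
qed

text \<open>Only multiples \<open>k\<close> of the order \<open>d\<close> of the rotation
  contribute. If \<open>d\<close> is even, all of them are even and the reflection always
  contributes \<open>m\<close>; if \<open>d\<close> is odd, they alternate in parity and the
  reflection contributes \<open>m\<close> and \<open>f\<close> equally often.\<close>

lemma cycle_count_reflection_rotation:
  assumes "a < m" "b < n"
  shows "2 * cycle_count m n (int a, True) (int b, False)
    = (if even (n div gcd b n) then 2 * m else m + reflection_fixed m a) * gcd b n"
proof -
  define d g f where "d = n div gcd b n" and "g = gcd b n" and "f = reflection_fixed m a"
  have mn: "m \<ge> 1" "n \<ge> 1" using assms by auto
  have n: "n = d * g" by (simp add: d_def g_def)
  have pos: "d > 0" "g > 0" using mn n by (auto intro: Nat.gr0I)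
  define S where "S = (\<Sum>k<2*m*n. (if even k then m else f) * (if d dvd k then n else 0))"
  have S: "cycle_count m n (int a, True) (int b, False) * (2 * m * n) = S"
    using assms unfolding S_def f_def d_def by (subst cycle_count_mult[OF mn])
      (auto simp: fixed_count_rotation[OF mn(2)] fixed_count_reflection dihedral_def)
  show ?thesis
  proof (cases "even d")
    case True
    have "S = (\<Sum>k<2*m*n. if d dvd k then m * n else 0)"
      unfolding S_def using True by (intro sum.cong) (auto dest: dvd_trans)
    also have "\<dots> = m * n * (2 * m * g)"
      using mn pos n by (subst sum_if_dvd) auto
    finally have "2 * cycle_count m n (int a, True) (int b, False) * (m * n) = 2 * m * g * (m * n)"
      using S by (simp add: algebra_simps)
    then show ?thesis using mn True by (simp add: d_def g_def)
  next
    case False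
    then have two_d: "2 * d dvd k \<longleftrightarrow> even k \<and> d dvd k" for k
      by (auto intro: divides_mult dest: dvd_mult_left dvd_mult_right)
    \<comment> \<open>Adding \<open>f * n\<close> at the multiples of \<open>2 * d\<close> splits
      the summand into \<open>m * n\<close> at these multiples and \<open>f * n\<close> at all
      multiples of \<open>d\<close>, without subtraction of naturals.\<close>
    have "S + f * n * (m * g) = S + (\<Sum>k<2*m*n. if 2 * d dvd k then f * n else 0)"
      using mn pos n by (subst sum_if_dvd) auto
    also have "\<dots> = (\<Sum>k<2*m*n. if 2 * d dvd k then m * n else 0)
        + (\<Sum>k<2*m*n. if d dvd k then f * n else 0)"
      unfolding S_def sum.distrib[symmetric] by (intro sum.cong) (auto simp: two_d)
    also have "\<dots> = m * n * (m * g) + f * n * (2 * m * g)"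
      using mn pos n by (simp add: sum_if_dvd)
    finally have "2 * cycle_count m n (int a, True) (int b, False) * (m * n) = (m + f) * g * (m * n)"
      using S by (simp add: algebra_simps)
    then have "2 * cycle_count m n (int a, True) (int b, False) = (m + f) * g"
      using mn by simp
    then show ?thesis using False by (simp add: d_def g_def f_def)
  qed
qed

lemma cycle_count_reflections:
  assumes "a < m" "b < n"
  shows "2 * cycle_count m n (int a, True) (int b, True)
    = m * n + reflection_fixed m a * reflection_fixed n b"
proof -
  define f f' where "f = reflection_fixed m a" and "f' = reflection_fixed n b"
  have mn: "m \<ge> 1" "n \<ge> 1" using assms by auto
  define S where "S = (\<Sum>k<2*m*n. (if even k then m else f) * (if even k then n else f'))"
  have S: "cycle_count m n (int a, True) (int b, True) * (2 * m * n) = S"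
    using assms unfolding S_def f_def f'_def by (subst cycle_count_mult[OF mn])
      (auto simp: fixed_count_reflection dihedral_def)
  \<comment> \<open>The same device, with the even \<open>k\<close> in place of the multiples of
    \<open>2 * d\<close>.\<close>
  have "S + f * f' * (m * n) = S + (\<Sum>k<2*m*n. if even k then f * f' else 0)"
    using mn by (subst sum_if_dvd) auto
  also have "\<dots> = (\<Sum>k<2*m*n. if even k then m * n else 0) + (\<Sum>k<2*m*n. f * f')"
    unfolding S_def sum.distrib[symmetric] by (intro sum.cong) auto
  also have "\<dots> = m * n * (m * n) + f * f' * (2 * m * n)"
    using mn by (subst sum_if_dvd) auto
  finally have "2 * cycle_count m n (int a, True) (int b, True) * (m * n) = (m * n + f * f') * (m * n)"
    using S by (simp add: algebra_simps)
  then show ?thesis using mn by (simp add: f_def f'_def)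
qed

section \<open>Summation over rotations and reflections\<close>

text \<open>The rotation by \<open>b\<close> positions of \<open>n\<close> indices has order \<open>n div gcd b n\<close>.\<close>

lemma sum_by_order:
  fixes K :: "nat \<Rightarrow> real"
  assumes "n \<ge> 1"
  shows "(\<Sum>b<n. K (n div gcd b n)) = (\<Sum>d | d dvd n. real (totient d) * K d)"
proof -
  have "(\<Sum>b<n. K (n div gcd b n)) = (\<Sum>b\<in>{0<..n}. K (n div gcd b n))"
  proof -
    \<comment> \<open>As \<open>gcd 0 n = gcd n n\<close>, the residue 0 can be traded for
      \<open>n\<close>, giving the range used by \<open>card_gcd_eq_totient\<close>.\<close>
    have "{..<n} = insert 0 {0<..<n}" "{0<..n} = insert n {0<..<n}" using assms by auto
    then show ?thesis by simp
  qed
  also have "\<dots> = (\<Sum>d | d dvd n. \<Sum>b | b \<in> {0<..n} \<and> n div gcd b n = d. K (n div gcd b n))"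
    using assms by (intro sum.group[symmetric]) (auto intro: div_gcd_dvd)
  also have "\<dots> = (\<Sum>d | d dvd n. real (totient d) * K d)"
  proof (rule sum.cong[OF refl])
    fix d assume "d \<in> {d. d dvd n}"
    then have d: "d dvd n" by simp
    have "{b. b \<in> {0<..n} \<and> n div gcd b n = d} = {b \<in> {0<..n}. gcd b n = n div d}"
    proof -
      have "n div gcd b n = d \<longleftrightarrow> gcd b n = n div d" for b
        using d assms by (metis dvd_mult_div_cancel gcd_dvd2 nonzero_mult_div_cancel_right
            not_one_le_zero mult.commute mult_eq_0_iff)
      then show ?thesis by auto
    qed
    moreover have "n div (n div d) = d" "n div d dvd n"
      using d assms by (auto intro: div_dvd_iff_mult[THEN iffD2])
    ultimately have "card {b. b \<in> {0<..n} \<and> n div gcd b n = d} = totient d"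
      using card_gcd_eq_totient[of n "n div d"] assms by simp
    then show "(\<Sum>b | b \<in> {0<..n} \<and> n div gcd b n = d. K (n div gcd b n)) = real (totient d) * K d"
      by simp
  qed
  finally show ?thesis .
qed

text \<open>For even \<open>m\<close>, half of the reflections have no fixed index and half have
  two. This averaging is the source of the paired powers in \<open>b2\<close>.\<close>

lemma sum_reflection_fixed:
  fixes H :: "nat \<Rightarrow> real"
  shows "(\<Sum>a<m. H (reflection_fixed m a)) = (if odd m then real m * H 1 else real m / 2 * (H 0 + H 2))"
proof (cases "odd m")
  case True
  then show ?thesis by (simp add: reflection_fixed_def)
next
  case False
  then obtain l where m: "m = 2 * l" by auto
  have "(\<Sum>a<2 * l. H (if even a then 0 else 2)) = real l * (H 0 + H 2)"
    by (induction l) (simp_all add: algebra_simps)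
  then show ?thesis by (simp add: reflection_fixed_def m)
qed

lemma two_power_half: "2 * c = k \<Longrightarrow> (2::real) ^ c = 2 powr (real k / 2)"
  by (auto simp: powr_realpow)

text \<open>The summand depends on \<open>a\<close> and \<open>b\<close> only through the orders of
  the rotations, so \<open>sum_by_order\<close> applies in each coordinate and produces the
  totients.\<close>

lemma sum_rotations:
  assumes "m \<ge> 1" "n \<ge> 1"
  shows "(\<Sum>a<m. \<Sum>b<n. 2 ^ cycle_count m n (int a, False) (int b, False))
    = 4 * real m * real n * b1 m n"
proof -
  define K :: "nat \<Rightarrow> nat \<Rightarrow> real" where "K = (\<lambda>c d. 2 powr (real m * real n / real (lcm c d)))"
  have "2 ^ cycle_count m n (int a, False) (int b, False) = K (m div gcd a m) (n div gcd b n)"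
    if "a < m" "b < n" for a b
  proof -
    have eq: "real (cycle_count m n (int a, False) (int b, False))
        * real (lcm (m div gcd a m) (n div gcd b n)) = real m * real n"
      using cycle_count_rotations[OF that] by (metis of_nat_mult)
    then have "real (lcm (m div gcd a m) (n div gcd b n)) \<noteq> 0" 
      using assms by (metis mult_eq_0_iff not_one_le_zero of_nat_eq_0_iff)
    with eq have "real (cycle_count m n (int a, False) (int b, False))
        = real m * real n / real (lcm (m div gcd a m) (n div gcd b n))"
      by (simp add: field_simps)
    then show ?thesis unfolding K_def by (simp flip: powr_realpow)
  qed
  then have "(\<Sum>a<m. \<Sum>b<n. 2 ^ cycle_count m n (int a, False) (int b, False))
      = (\<Sum>a<m. \<Sum>b<n. K (m div gcd a m) (n div gcd b n))"
    by simp
  also have "\<dots> = (\<Sum>a<m. \<Sum>d | d dvd n. real (totient d) * K (m div gcd a m) d)"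
    using sum_by_order[OF assms(2)] by simp
  also have "\<dots> = (\<Sum>c | c dvd m. real (totient c) * (\<Sum>d | d dvd n. real (totient d) * K c d))"
    by (rule sum_by_order[OF assms(1)])
  finally show ?thesis
    using assms by (simp add: b1_def K_def sum_distrib_left mult.assoc)
qed

text \<open>For \<open>b > 0\<close> the summand is compared with
  \<open>2 powr (m * gcd b n)\<close>: they agree for even order, and for odd order the bracket is
  the difference. Grouping the comparison terms by order gives the totient sum over \<open>d\<close>
  from 2 on; the first summand is the case \<open>b = 0\<close>.\<close>

lemma sum_reflection_rotations:
  fixes f m n :: nat
  assumes n: "n \<ge> 1"
  shows "(\<Sum>b<n. 2 powr (real ((if even (n div gcd b n) then 2 * m else m + f) * gcd b n) / 2))
    = 2 powr (real (m + f) * real n / 2)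
      + (\<Sum>d | 2 \<le> d \<and> d dvd n. real (totient d) * 2 powr (real m * real n / real d))
      + (\<Sum>j | 1 \<le> j \<and> j \<le> n - 1 \<and> odd (n div gcd j n).
          2 powr (real (m + f) * real (gcd j n) / 2) - 2 powr (real m * real (gcd j n)))"
    (is "sum ?h _ = _ + ?D + sum ?e ?J")
proof -
  let ?K = "\<lambda>d. 2 powr (real m * real n / real d) :: real"
  have order: "?K (n div gcd b n) = 2 powr (real m * real (gcd b n))" for b
    using n by (simp add: real_of_nat_div)
  have "2 \<le> d \<longleftrightarrow> d \<noteq> 1" if "d dvd n" for d
    using that n by (cases d) auto
  then have divs: "{d. d dvd n} = insert 1 {d. 2 \<le> d \<and> d dvd n}"
    by auto
  have range: "{..<n} = insert 0 {1..<n}" and J: "?J = {b \<in> {1..<n}. odd (n div gcd b n)}"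
    using n by auto
  have fin: "finite {d. 2 \<le> d \<and> d dvd n}"
    using n by (intro finite_subset[OF _ finite_divisors_nat[of n]]) auto
  \<comment> \<open>The rotation by 0 is the only one of order 1, so its term cancels against
    \<open>d = 1\<close>.\<close>
  have "?K 1 + (\<Sum>b=1..<n. ?K (n div gcd b n)) = (\<Sum>b<n. ?K (n div gcd b n))"
    using n by (simp add: range)
  also have "\<dots> = (\<Sum>d | d dvd n. real (totient d) * ?K d)"
    by (rule sum_by_order[OF n])
  also have "\<dots> = ?K 1 + ?D"
    using fin unfolding divs by simp
  finally have D: "(\<Sum>b=1..<n. ?K (n div gcd b n)) = ?D" by simp
  have "(\<Sum>b<n. ?h b) = 2 powr (real (m + f) * real n / 2) + (\<Sum>b=1..<n. ?h b)"
    using n by (simp add: range)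
  also have "(\<Sum>b=1..<n. ?h b) = (\<Sum>b=1..<n. ?K (n div gcd b n) + (if odd (n div gcd b n) then ?e b else 0))"
    unfolding order by (intro sum.cong) auto
  also have "\<dots> = ?D + sum ?e ?J"
    unfolding sum.distrib D J by (subst sum.inter_filter) simp_all
  finally show ?thesis by simp
qed

lemma sum_reflections_rotations:
  assumes "m \<ge> 1" "n \<ge> 1"
  shows "(\<Sum>a<m. \<Sum>b<n. 2 ^ cycle_count m n (int a, True) (int b, False))
    = 4 * real m * real n * b2 m n"
proof -
  define H :: "nat \<Rightarrow> real" where
    "H = (\<lambda>f. \<Sum>b<n. 2 powr (real ((if even (n div gcd b n) then 2 * m else m + f) * gcd b n) / 2))"
  have H: "H f = 2 powr (real (m + f) * real n / 2)
      + (\<Sum>d | 2 \<le> d \<and> d dvd n. real (totient d) * 2 powr (real m * real n / real d))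
      + (\<Sum>j | 1 \<le> j \<and> j \<le> n - 1 \<and> odd (n div gcd j n).
          2 powr (real (m + f) * real (gcd j n) / 2) - 2 powr (real m * real (gcd j n)))" for f
    unfolding H_def by (rule sum_reflection_rotations[OF assms(2)])
  have "(\<Sum>a<m. \<Sum>b<n. 2 ^ cycle_count m n (int a, True) (int b, False))
      = (\<Sum>a<m. H (reflection_fixed m a))"
    unfolding H_def using two_power_half[OF cycle_count_reflection_rotation] by (intro sum.cong refl) auto
  also have "\<dots> = (if odd m then real m * H 1 else real m / 2 * (H 0 + H 2))"
    by (rule sum_reflection_fixed)
  also have "\<dots> = 4 * real m * real n * b2 m n"
  proof (cases "odd m")
    case True
    then show ?thesis
      using assms unfolding b2_def H by (simp add: distrib_left add_divide_distrib add.commute)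
  next
    case False
    let ?J = "{j. 1 \<le> j \<and> j \<le> n - 1 \<and> odd (n div gcd j n)}"
    let ?D = "\<Sum>d | 2 \<le> d \<and> d dvd n. real (totient d) * 2 powr (real m * real n / real d)"
    \<comment> \<open>Both values of \<open>H\<close> contain \<open>?D\<close> and subtract the
      same powers; the doubled subtrahend is the power with exponent raised by 1.\<close>
    have "H 0 + H 2 = 2 powr (real m * real n / 2) + 2 powr ((real m + 2) * real n / 2) + 2 * ?D
       + (\<Sum>j\<in>?J. 2 powr (real m * real (gcd j n) / 2) + 2 powr ((real m + 2) * real (gcd j n) / 2)
           - 2 powr (real m * real (gcd j n) + 1))"
      unfolding H by (simp add: powr_add sum.distrib sum_subtractf add.commute[of 2]
          flip: sum_distrib_left sum_distrib_right)
    then show ?thesis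
      using assms False by (simp add: b2_def field_simps)
  qed
  finally show ?thesis .
qed

lemma sum_reflections:
  assumes "m \<ge> 1" "n \<ge> 1"
  shows "(\<Sum>a<m. \<Sum>b<n. 2 ^ cycle_count m n (int a, True) (int b, True))
    = 4 * real m * real n * b4 m n"
proof -
  define H :: "nat \<Rightarrow> nat \<Rightarrow> real" where "H = (\<lambda>f f'. 2 powr (real (m * n + f * f') / 2))"
  have "(\<Sum>a<m. \<Sum>b<n. 2 ^ cycle_count m n (int a, True) (int b, True))
      = (\<Sum>a<m. \<Sum>b<n. H (reflection_fixed m a) (reflection_fixed n b))"
    unfolding H_def using two_power_half[OF cycle_count_reflections] by (intro sum.cong refl) auto
  also have "\<dots> = (\<Sum>a<m. if odd n then real n * H (reflection_fixed m a) 1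
      else real n / 2 * (H (reflection_fixed m a) 0 + H (reflection_fixed m a) 2))"
    by (simp only: sum_reflection_fixed)
  also have "\<dots> = (if odd m then real m * (if odd n then real n * H 1 1 else real n / 2 * (H 1 0 + H 1 2))
      else real m / 2 * ((if odd n then real n * H 0 1 else real n / 2 * (H 0 0 + H 0 2))
        + (if odd n then real n * H 2 1 else real n / 2 * (H 2 0 + H 2 2))))"
    by (rule sum_reflection_fixed)
  also have "\<dots> = 4 * real m * real n * b4 m n"
  proof -
    let ?P = "2 powr (real m * real n / 2) :: real"
    \<comment> \<open>Apart from \<open>?P\<close>, the average of
      \<open>2 powr (f * f' / 2)\<close> remains: the square root of 2 if both sizes are odd,
      \<open>(1 + 2) / 2\<close> for opposite parity, and \<open>(1 + 1 + 1 + 4) / 4\<close> if both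
      are even. Hence the factors 3 and 7 in \<open>b4\<close>.\<close>
    have H: "H f f' = ?P * 2 powr (real (f * f') / 2)" for f f'
      by (simp add: H_def add_divide_distrib powr_add)
    have half: "2 powr ((real m * real n - 3) / 2) = ?P * 2 powr (1/2) / (4::real)"
    proof -
      have "(real m * real n - 3) / 2 = real m * real n / 2 + 1/2 - 2" by (simp add: field_simps)
      then show ?thesis by (simp only: powr_add powr_diff) simp
    qed
    show ?thesis
      unfolding H b4_def half powr_diff by (auto simp: field_simps)
  qed
  finally show ?thesis .
qed

section \<open>Assembling the four blocks of the group\<close>

lemma carrier_dihedral_eq:
  "carrier (dihedral m) = (\<lambda>a. (int a, False)) ` {..<m} \<union> (\<lambda>a. (int a, True)) ` {..<m}"
proof -
  have "{0..<int m} = int ` {..<m}"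
    by (simp add: image_int_atLeastLessThan lessThan_atLeast0)
  then show ?thesis by (auto simp: dihedral_def)
qed

lemma sum_carrier_dihedral:
  "sum \<phi> (carrier (dihedral m)) = (\<Sum>a<m. \<phi> (int a, False)) + (\<Sum>a<m. \<phi> (int a, True))"
  unfolding carrier_dihedral_eq
  by (subst sum.union_disjoint) (auto simp: sum.reindex inj_on_def)

theorem theorem2:
  fixes m n :: nat
  assumes "m \<ge> 1" and "n \<ge> 1"
  shows "real (toroidal_count m n) = b1 m n + b2 m n + b3 m n + b4 m n"
proof -
  let ?G = "dihedral m \<times>\<times> dihedral n"
  interpret group_action ?G "arrays m n" "array_action m n"
    using group_action_array_action[OF assms] .
  have fin: "finite (carrier (dihedral k))" for k
    by (simp add: dihedral_def)
  \<comment> \<open>Burnside's lemma averages over all \<open>4 * m * n\<close> group elements, even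
    where distinct ones act alike.\<close>
  have "toroidal_count m n * order ?G
      = (\<Sum>gh\<in>carrier ?G. card (invariants (arrays m n) (array_action m n) gh))"
    unfolding toroidal_count_def by (rule burnside) (simp_all add: fin arrays_def cells_def finite_PiE)
  also have "\<dots> = (\<Sum>g\<in>carrier (dihedral m). \<Sum>h\<in>carrier (dihedral n). 2 ^ cycle_count m n g h)"
    by (auto simp: sum.cartesian_product card_invariants_array_action[OF assms] DirProd_def intro!: sum.cong)
  finally have "toroidal_count m n * (4 * m * n)
      = (\<Sum>g\<in>carrier (dihedral m). \<Sum>h\<in>carrier (dihedral n). 2 ^ cycle_count m n g h)"
    using order_dihedral[of m] order_dihedral[of n]
    by (simp add: order_def card_cartesian_product algebra_simps)
  then have "real (toroidal_count m n) * (4 * real m * real n)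
      = real (\<Sum>g\<in>carrier (dihedral m). \<Sum>h\<in>carrier (dihedral n). 2 ^ cycle_count m n g h)"
    by (metis of_nat_mult of_nat_numeral)
  also have "\<dots> = (\<Sum>g\<in>carrier (dihedral m). \<Sum>h\<in>carrier (dihedral n). 2 ^ cycle_count m n g h)"
    by simp
  also have "\<dots> = 4 * real m * real n * b1 m n + 4 * real m * real n * b2 m n
      + 4 * real n * real m * b2 n m + 4 * real m * real n * b4 m n"
  proof -
    \<comment> \<open>Exchanging rows and columns turns the block of row rotations with column
      reflections into the one already summed, which yields \<open>b2 n m\<close>.\<close>
    have "(\<Sum>a<m. \<Sum>b<n. 2 ^ cycle_count m n (int a, False) (int b, True) :: real)
        = (\<Sum>b<n. \<Sum>a<m. 2 ^ cycle_count n m (int b, True) (int a, False))"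
      by (subst sum.swap) (simp add: cycle_count_swap)
    then show ?thesis
      unfolding sum_carrier_dihedral sum.distrib
        sum_rotations[OF assms, symmetric] sum_reflections[OF assms, symmetric]
        sum_reflections_rotations[OF assms, symmetric] sum_reflections_rotations[OF assms(2,1), symmetric]
      by simp
  qed
  also have "\<dots> = (b1 m n + b2 m n + b3 m n + b4 m n) * (4 * real m * real n)"
    by (simp add: b3_def algebra_simps)
  finally show ?thesis using assms by simp
qed

end
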